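(* Let $f:G_1\to G_2$ be an epimorphism of groups and let $Q$ be a quasi-normal subgroup of $G_1$. Then $f(Q)$ is quasi-normal in $G_2$. Moreover, commensuration data for $(g,Q,G_1)$ for all $g\in G_1$ and for $(g_2,f(Q),G_2)$ for all $g_2\in G_2$ can be chosen so that for all $g\in G_1$: 1) $A(f(g),f(Q),G_2)=f(A(g,Q,G_1))$; 2) $\alpha_{(f(g),f(Q),G_2)}(f(q))=f(\alpha_{(g,Q,G_1)}(q))$ for all $q\in Q$; 3) $\beta_{(f(g),f(Q),G_2)}(f(q))=f(\beta_{(g,Q,G_1)}(q))$ for all $q\in Q$.
   Context: For a subgroup $H$ of a group $G$, the commensurator of $H$ in $G$ is $Comm(H,G)=\{g\in G : gHg^{-1}\cap H \text{ has finite index in both } H \text{ and } gHg^{-1}\}$. A subgroup $Q$ of $G$ is quasi-normal in $G$ if $Comm(Q,G)=G$. For $g\in Comm(H,G)$, commensuration data for $(g,H,G)$ means a finite subset $A(g,H,G)$ of $HgH$ and functions $\alpha_{(g,H,G)}:H\to A(g,H,G)$ and $\beta_{(g,H,G)}:H\to (A(g,H,G))^{-1}$ such that: for each $h\in H$, $h\,\alpha_{(g,H,G)}(h)\in gH$ and $gh\,\beta_{(g,H,G)}(h)\in H$; $\mathrm{image}(\alpha_{(g,H,G)})\cup(\mathrm{image}(\beta_{(g,H,G)}))^{-1}=A(g,H,G)$; and for each $a\in A(g,H,G)$ there are $h_1,h_2\in H$ with $h_1a\in gH$ and $gh_2a^{-1}\in H$. Such data exist for every $g\in Comm(H,G)$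 but are not unique. *)

theory Defs
  imports "HOL-Algebra.Coset"
begin

definition conj_set :: "('a, 'm) monoid_scheme \<Rightarrow> 'a \<Rightarrow> 'a set \<Rightarrow> 'a set" where
  "conj_set G g H = (g <#\<^bsub>G\<^esub> H) #>\<^bsub>G\<^esub> inv\<^bsub>G\<^esub> g"

text \<open>Cosets are formed in the group \<^term>\<open>H\<close> itself, so this is the index of \<^term>\<open>K\<close> in
  \<^term>\<open>H\<close> and not in \<^term>\<open>G\<close>. Finiteness is required of the set of cosets because
  \<^const>\<open>card\<close> is 0 on infinite sets.\<close>

definition finite_index_in :: "('a, 'm) monoid_scheme \<Rightarrow> 'a set \<Rightarrow> 'a set \<Rightarrow> bool" where
  "finite_index_in G K H \<longleftrightarrow>
     subgroup K (G\<lparr>carrier := H\<rparr>) \<and> finite (rcosets\<^bsub>G\<lparr>carrier := H\<rparr>\<^esub> K)"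

definition commensurator :: "'a set \<Rightarrow> ('a, 'm) monoid_scheme \<Rightarrow> 'a set" where
  "commensurator H G =
     {g \<in> carrier G. finite_index_in G (conj_set G g H \<inter> H) H \<and>
                     finite_index_in G (conj_set G g H \<inter> H) (conj_set G g H)}"

definition quasi_normal :: "'a set \<Rightarrow> ('a, 'm) monoid_scheme \<Rightarrow> bool" where
  "quasi_normal Q G \<longleftrightarrow> subgroup Q G \<and> commensurator Q G = carrier G"

text \<open>The values of \<^term>\<open>\<alpha>\<close> and \<^term>\<open>\<beta>\<close> outside \<^term>\<open>H\<close> are irrelevant.\<close>

definition commensuration_data ::
  "'a \<Rightarrow> 'a set \<Rightarrow> ('a, 'm) monoid_scheme \<Rightarrow> 'a set \<Rightarrow> ('a \<Rightarrow> 'a) \<Rightarrow> ('a \<Rightarrow> 'a) \<Rightarrow> bool" where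
  "commensuration_data g H G A \<alpha> \<beta> \<longleftrightarrow>
     g \<in> commensurator H G \<and>
     finite A \<and> A \<subseteq> H <#>\<^bsub>G\<^esub> (g <#\<^bsub>G\<^esub> H) \<and>
     \<alpha> \<in> H \<rightarrow> A \<and> \<beta> \<in> H \<rightarrow> set_inv\<^bsub>G\<^esub> A \<and>
     (\<forall>h\<in>H. h \<otimes>\<^bsub>G\<^esub> \<alpha> h \<in> g <#\<^bsub>G\<^esub> H \<and> g \<otimes>\<^bsub>G\<^esub> h \<otimes>\<^bsub>G\<^esub> \<beta> h \<in> H) \<and>
     \<alpha> ` H \<union> set_inv\<^bsub>G\<^esub> (\<beta> ` H) = A \<and>
     (\<forall>a\<in>A. \<exists>h\<^sub>1\<in>H. \<exists>h\<^sub>2\<in>H. h\<^sub>1 \<otimes>\<^bsub>G\<^esub> a \<in> g <#\<^bsub>G\<^esub> H \<and> g \<otimes>\<^bsub>G\<^esub> h\<^sub>2 \<otimes>\<^bsub>G\<^esub> inv\<^bsub>G\<^esub> a \<in> H)"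

end

theory Submission
  imports Defs
begin

text \<open>Fix a representative \<open>\<rho> C\<close> of every left coset \<open>C\<close> of \<open>H\<close>. Then \<open>\<alpha> h = \<rho> (h\<inverse>gH)\<close> and
  \<open>\<beta> h = \<rho> (h\<inverse>g\<inverse>H)\<close> give commensuration data for \<open>g\<close>, with \<open>A\<close> read off from the images; these
  are finite because the stabiliser of \<open>gH\<close> in \<open>H\<close> is \<open>gHg\<inverse> \<inter> H\<close>, and
  similarly for \<open>g\<inverse>\<close>. Since \<open>\<rho>\<close> does not depend on
  \<open>g\<close>, compatibility with \<open>f\<close> reduces to choosing representatives \<open>r\<close> of the cosets of \<open>f Q\<close>
  first, and then each representative \<open>\<rho> C\<close> of a coset of \<open>Q\<close> above \<open>r (f C)\<close>.\<close>

text \<open>The orbit of the left coset \<open>gH\<close> under left multiplication by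
  \<open>H\<close>. The inverse on \<open>q\<close> is there because
  \<open>q \<otimes> \<alpha> q \<in> gH\<close> places \<open>\<alpha> q\<close> in the translate
  of \<open>gH\<close> by \<open>inv q\<close>.\<close>

definition translates :: "('a, 'm) monoid_scheme \<Rightarrow> 'a set \<Rightarrow> 'a \<Rightarrow> 'a set set" where
  "translates G H g = (\<lambda>q. (inv\<^bsub>G\<^esub> q \<otimes>\<^bsub>G\<^esub> g) <#\<^bsub>G\<^esub> H) ` H"

text \<open>Two functions with the same fibres on \<open>S\<close> have images in bijection: sending
  \<open>u x\<close> to \<open>v x\<close> is well defined and injective.\<close>

lemma finite_image_iff_same_kernel:
  assumes "\<And>x y. x \<in> S \<Longrightarrow> y \<in> S \<Longrightarrow> u x = u y \<longleftrightarrow> v x = v y"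
  shows "finite (u ` S) \<longleftrightarrow> finite (v ` S)"
proof -
  have "bij_betw (\<lambda>a. v (inv_into S u a)) (u ` S) (v ` S)"
  proof (rule bij_betw_imageI)
    show "inj_on (\<lambda>a. v (inv_into S u a)) (u ` S)"
      by (intro inj_onI) (metis assms f_inv_into_f inv_into_into)
    have "v (inv_into S u (u x)) = v x" if "x \<in> S" for x
      using that assms by (metis f_inv_into_f imageI inv_into_into)
    then show "(\<lambda>a. v (inv_into S u a)) ` u ` S = v ` S"
      by (simp add: image_image)
  qed
  then show ?thesis by (rule bij_betw_finite)
qed

context group
begin

lemma inv_mult_cancel:
  assumes "x \<in> carrier G" "y \<in> carrier G"
  shows "inv x \<otimes> (x \<otimes> y) = y" "x \<otimes> (inv x \<otimes> y) = y"
  using assms by (simp_all flip: m_assoc)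

lemma conj_set_eq_image:
  assumes "g \<in> carrier G" "H \<subseteq> carrier G"
  shows "conj_set G g H = (\<lambda>h. g \<otimes> h \<otimes> inv g) ` H"
  by (auto simp: conj_set_def l_coset_def r_coset_def)

lemma mem_conj_set_iff:
  assumes "g \<in> carrier G" "H \<subseteq> carrier G" "x \<in> carrier G"
  shows "x \<in> conj_set G g H \<longleftrightarrow> inv g \<otimes> x \<otimes> g \<in> H"
proof
  assume "x \<in> conj_set G g H"
  then obtain h where h: "h \<in> H" "x = g \<otimes> h \<otimes> inv g"
    using assms by (auto simp: conj_set_eq_image)
  then have "inv g \<otimes> x \<otimes> g = h"
    using assms by (simp add: subsetD m_assoc inv_mult_cancel)
  then show "inv g \<otimes> x \<otimes> g \<in> H" using h by simp
next
  assume "inv g \<otimes> x \<otimes> g \<in> H"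
  moreover have "x = g \<otimes> (inv g \<otimes> x \<otimes> g) \<otimes> inv g"
    using assms by (simp add: m_assoc inv_mult_cancel)
  ultimately show "x \<in> conj_set G g H"
    using assms by (auto simp: conj_set_eq_image)
qed

lemma subgroup_conj_set:
  assumes "g \<in> carrier G" "subgroup H G"
  shows "subgroup (conj_set G g H) G"
proof -
  interpret H: subgroup H G by fact
  have sub: "conj_set G g H \<subseteq> carrier G"
    using assms by (auto simp: conj_set_eq_image H.subset)
  show ?thesis
  proof (rule subgroupI)
    show "conj_set G g H \<subseteq> carrier G" by (rule sub)
    show "conj_set G g H \<noteq> {}"
      using assms(1) H.subset H.one_closed by (subst conj_set_eq_image) blast+
  next
    fix x assume x: "x \<in> conj_set G g H"
    then have xc: "x \<in> carrier G" using sub by auto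
    have "inv g \<otimes> inv x \<otimes> g = inv (inv g \<otimes> x \<otimes> g)"
      using assms xc by (simp add: inv_mult_group m_assoc)
    then show "inv x \<in> conj_set G g H"
      using x xc assms by (simp add: mem_conj_set_iff H.subset)
  next
    fix x y assume x: "x \<in> conj_set G g H" and y: "y \<in> conj_set G g H"
    then have xc: "x \<in> carrier G" and yc: "y \<in> carrier G" using sub by auto
    have "inv g \<otimes> (x \<otimes> y) \<otimes> g = (inv g \<otimes> x \<otimes> g) \<otimes> (inv g \<otimes> y \<otimes> g)"
      using assms xc yc by (simp add: m_assoc inv_mult_cancel)
    then show "x \<otimes> y \<in> conj_set G g H"
      using x y xc yc assms by (simp add: mem_conj_set_iff H.subset)
  qed
qed

lemma l_coset_eq_iff:
  assumes "subgroup H G" "x \<in> carrier G" "y \<in> carrier G"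
  shows "x <# H = y <# H \<longleftrightarrow> inv x \<otimes> y \<in> H"
proof
  interpret H: subgroup H G by fact
  assume "x <# H = y <# H"
  moreover have "y \<in> y <# H"
    using assms H.one_closed by (force simp: l_coset_def)
  ultimately obtain h where "h \<in> H" "y = x \<otimes> h" by (auto simp: l_coset_def)
  then show "inv x \<otimes> y \<in> H" using assms by (simp add: inv_mult_cancel)
next
  interpret H: subgroup H G by fact
  assume h: "inv x \<otimes> y \<in> H"
  have "y = x \<otimes> (inv x \<otimes> y)" using assms by (simp add: inv_mult_cancel)
  then have "y \<in> x <# H" using h by (auto simp: l_coset_def)
  then show "x <# H = y <# H"
    using assms by (metis l_repr_independence)
qed

lemma r_coset_eq_iff:
  assumes "subgroup H G" "x \<in> carrier G" "y \<in> carrier G"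
  shows "H #> x = H #> y \<longleftrightarrow> x \<otimes> inv y \<in> H"
  using assms
  by (metis rcos_self repr_independence subgroup.rcos_module group_axioms)

text \<open>Orbit-stabiliser in a form fit for counting: for \<open>x\<close>, \<open>y\<close> in
  \<open>L\<close> the product \<open>x \<otimes> inv y\<close> lies in \<open>L\<close> anyway, so
  the fibres of \<open>v\<close> on \<open>L\<close> are exactly the right cosets of
  \<open>M \<inter> L\<close> in \<open>L\<close>.\<close>

lemma finite_index_in_Int_iff:
  assumes M: "subgroup M G" and L: "subgroup L G"
    and v: "\<And>x y. x \<in> L \<Longrightarrow> y \<in> L \<Longrightarrow> v x = v y \<longleftrightarrow> x \<otimes> inv y \<in> M"
  shows "finite_index_in G (M \<inter> L) L \<longleftrightarrow> finite (v ` L)"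
proof -
  interpret L: group "G\<lparr>carrier := L\<rparr>"
    using L by (rule subgroup_imp_group)
  have K: "subgroup (M \<inter> L) (G\<lparr>carrier := L\<rparr>)"
    using M L by (intro subgroup_incl subgroups_Inter_pair) auto
  have rc: "rcosets\<^bsub>G\<lparr>carrier := L\<rparr>\<^esub> (M \<inter> L) = (\<lambda>x. (M \<inter> L) #>\<^bsub>G\<lparr>carrier := L\<rparr>\<^esub> x) ` L"
    by (auto simp: RCOSETS_def)
  have "((M \<inter> L) #>\<^bsub>G\<lparr>carrier := L\<rparr>\<^esub> x = (M \<inter> L) #>\<^bsub>G\<lparr>carrier := L\<rparr>\<^esub> y) \<longleftrightarrow> v x = v y"
    if "x \<in> L" "y \<in> L" for x y
    using that L.r_coset_eq_iff[OF K] v L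
    by (simp add: subgroup.m_closed subgroup.m_inv_closed)
  then show ?thesis
    using K finite_image_iff_same_kernel[of L "\<lambda>x. (M \<inter> L) #>\<^bsub>G\<lparr>carrier := L\<rparr>\<^esub> x" v]
    by (simp add: finite_index_in_def rc)
qed

text \<open>By \<open>mem_conj_set_iff\<close> the right-hand side says that
  \<open>x \<otimes> inv y\<close> lies in \<open>conj_set G g H\<close>, the stabiliser of
  \<open>gH\<close>. This is the hypothesis on \<open>v\<close> in
  \<open>finite_index_in_Int_iff\<close>.\<close>

lemma translates_eq_iff:
  assumes "subgroup H G" "g \<in> carrier G" "x \<in> carrier G" "y \<in> carrier G"
  shows "(inv x \<otimes> g) <# H = (inv y \<otimes> g) <# H \<longleftrightarrow> inv g \<otimes> (x \<otimes> inv y) \<otimes> g \<in> H"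
  using assms by (simp add: l_coset_eq_iff inv_mult_group m_assoc)

text \<open>The index in \<open>H\<close> is counted by the translates of \<open>gH\<close>.
  Conjugation by \<open>inv g\<close> carries \<open>conj_set G g H\<close> to \<open>H\<close> and
  \<open>H\<close> to \<open>conj_set G (inv g) H\<close>, so the index in the conjugate is counted
  by the translates of the coset of \<open>inv g\<close>.\<close>

lemma mem_commensurator_iff:
  assumes H: "subgroup H G" and g: "g \<in> carrier G"
  shows "g \<in> commensurator H G \<longleftrightarrow>
    finite (translates G H g) \<and> finite (translates G H (inv g))"
proof -
  interpret H: subgroup H G by fact
  let ?L = "conj_set G g H"
  have L: "subgroup ?L G" using subgroup_conj_set g H by blast
  have one: "finite_index_in G (?L \<inter> H) H \<longleftrightarrow> finite (translates G H g)"
    unfolding translates_def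
    by (rule finite_index_in_Int_iff[OF L H])
      (use g in \<open>simp add: translates_eq_iff H mem_conj_set_iff H.subset\<close>)
  \<comment> \<open>This is the translate map for \<open>inv g\<close>, precomposed with the
    conjugation that sends \<open>?L\<close> onto \<open>H\<close>.\<close>
  let ?v = "\<lambda>x. (inv (inv g \<otimes> x \<otimes> g) \<otimes> inv g) <# H"
  have "?v x = ?v y \<longleftrightarrow> x \<otimes> inv y \<in> H" if "x \<in> ?L" "y \<in> ?L" for x y
  proof -
    have c: "x \<in> carrier G" "y \<in> carrier G"
      using that subgroup.subset[OF L] by auto
    have "inv (inv g) \<otimes> ((inv g \<otimes> x \<otimes> g) \<otimes> inv (inv g \<otimes> y \<otimes> g)) \<otimes> inv g = x \<otimes> inv y"
      using c g by (simp add: inv_mult_group m_assoc inv_mult_cancel)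
    then show ?thesis
      using c g by (subst translates_eq_iff[OF H]) simp_all
  qed
  then have "finite_index_in G (H \<inter> ?L) ?L \<longleftrightarrow> finite (?v ` ?L)"
    by (rule finite_index_in_Int_iff[OF H L])
  moreover have "?v ` ?L = translates G H (inv g)"
  proof -
    have "inv g \<otimes> (g \<otimes> h \<otimes> inv g) \<otimes> g = h" if "h \<in> H" for h
      using that g by (simp add: m_assoc inv_mult_cancel)
    then show ?thesis
      using g by (simp add: translates_def conj_set_eq_image H.subset image_image)
  qed
  ultimately show ?thesis
    using one g by (simp add: commensurator_def Int_commute)
qed

text \<open>The two membership conditions on \<open>\<alpha> q\<close> and \<open>\<beta> q\<close>
  say precisely that they lie in the left cosets of \<open>inv q \<otimes> g\<close> and
  \<open>inv q \<otimes> inv g\<close>, so any choice of representatives satisfies them. The image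
  condition then forces \<open>A\<close>.\<close>

lemma commensuration_data_of_transversal:
  fixes g H \<rho>
  defines "\<alpha> \<equiv> \<lambda>q. \<rho> ((inv q \<otimes> g) <# H)"
    and "\<beta> \<equiv> \<lambda>q. \<rho> ((inv q \<otimes> inv g) <# H)"
  assumes H: "subgroup H G" and gC: "g \<in> commensurator H G"
    and rho: "\<And>x. x \<in> carrier G \<Longrightarrow> \<rho> (x <# H) \<in> x <# H"
  shows "commensuration_data g H G (\<alpha> ` H \<union> set_inv (\<beta> ` H)) \<alpha> \<beta>"
proof -
  interpret H: subgroup H G by fact
  have g: "g \<in> carrier G" using gC by (simp add: commensurator_def)
  have fin: "finite (translates G H g)" "finite (translates G H (inv g))"
    using gC mem_commensurator_iff[OF H g] by auto
  have \<alpha>: "\<exists>h\<in>H. \<alpha> q = inv q \<otimes> g \<otimes> h" if "q \<in> H" for q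
    using rho[of "inv q \<otimes> g"] that g by (auto simp: \<alpha>_def l_coset_def)
  have \<beta>: "\<exists>h\<in>H. \<beta> q = inv q \<otimes> inv g \<otimes> h" if "q \<in> H" for q
    using rho[of "inv q \<otimes> inv g"] that g by (auto simp: \<beta>_def l_coset_def)
  have \<beta>c: "\<beta> q \<in> carrier G" if "q \<in> H" for q
    using \<beta>[OF that] that g by auto
  have "\<alpha> ` H = \<rho> ` translates G H g" "\<beta> ` H = \<rho> ` translates G H (inv g)"
    by (simp_all add: \<alpha>_def \<beta>_def translates_def image_image)
  then have finA: "finite (\<alpha> ` H \<union> set_inv (\<beta> ` H))"
    using fin by (simp add: SET_INV_def)
  \<comment> \<open>Inverting a value \<open>inv q \<otimes> inv g \<otimes> h\<close> of
    \<open>\<beta>\<close> gives \<open>inv h \<otimes> g \<otimes> q\<close>, again in the double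
    coset. The factorisation yields both the inclusion of \<open>A\<close> and the final clause of
    the data.\<close>
  have dbl: "\<exists>h\<in>H. \<exists>k\<in>H. a = h \<otimes> (g \<otimes> k)" if "a \<in> \<alpha> ` H \<union> set_inv (\<beta> ` H)" for a
    using that
  proof
    assume "a \<in> \<alpha> ` H"
    then obtain q h where "q \<in> H" "h \<in> H" "a = inv q \<otimes> g \<otimes> h" using \<alpha> by blast
    then have "inv q \<in> H" "a = inv q \<otimes> (g \<otimes> h)" using g by (simp_all add: m_assoc)
    then show ?thesis using \<open>h \<in> H\<close> by blast
  next
    assume "a \<in> set_inv (\<beta> ` H)"
    then obtain q h where "q \<in> H" "h \<in> H" "a = inv (inv q \<otimes> inv g \<otimes> h)"
      using \<beta> by (fastforce simp: SET_INV_def)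
    then have "inv h \<in> H" "a = inv h \<otimes> (g \<otimes> q)" using g by (simp_all add: m_assoc inv_mult_group)
    then show ?thesis using \<open>q \<in> H\<close> by blast
  qed
  have sub: "\<alpha> ` H \<union> set_inv (\<beta> ` H) \<subseteq> H <#> (g <# H)"
    using dbl by (fastforce simp: set_mult_def l_coset_def)
  have \<beta>A: "\<beta> q \<in> set_inv (\<alpha> ` H \<union> set_inv (\<beta> ` H))" if "q \<in> H" for q
  proof -
    have "inv (\<beta> q) \<in> \<alpha> ` H \<union> set_inv (\<beta> ` H)" "\<beta> q = inv (inv (\<beta> q))"
      using that \<beta>c by (auto simp: SET_INV_def)
    then show ?thesis unfolding SET_INV_def by blast
  qed
  have ab: "q \<otimes> \<alpha> q \<in> g <# H" "g \<otimes> q \<otimes> \<beta> q \<in> H" if q: "q \<in> H" for q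
  proof -
    obtain h where h: "h \<in> H" "\<alpha> q = inv q \<otimes> g \<otimes> h" using \<alpha>[OF q] by blast
    then have "q \<otimes> \<alpha> q = g \<otimes> h" using q g by (simp add: m_assoc inv_mult_cancel)
    then show "q \<otimes> \<alpha> q \<in> g <# H" using h by (auto simp: l_coset_def)
    obtain k where k: "k \<in> H" "\<beta> q = inv q \<otimes> inv g \<otimes> k" using \<beta>[OF q] by blast
    then have "\<beta> q = inv (g \<otimes> q) \<otimes> k" using q g by (simp add: inv_mult_group)
    then have "g \<otimes> q \<otimes> \<beta> q = k" using q g k(1) by (simp add: m_assoc inv_mult_group inv_mult_cancel)
    then show "g \<otimes> q \<otimes> \<beta> q \<in> H" using k by simp
  qed
  \<comment> \<open>For \<open>a = h \<otimes> (g \<otimes> k)\<close> the witnesses are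
    \<open>inv h\<close> and \<open>k\<close>: the two products are \<open>g \<otimes> k\<close> and
    \<open>inv h\<close>.\<close>
  have last: "\<exists>h\<^sub>1\<in>H. \<exists>h\<^sub>2\<in>H. h\<^sub>1 \<otimes> a \<in> g <# H \<and> g \<otimes> h\<^sub>2 \<otimes> inv a \<in> H"
    if "a \<in> \<alpha> ` H \<union> set_inv (\<beta> ` H)" for a
  proof -
    obtain h k where hk: "h \<in> H" "k \<in> H" "a = h \<otimes> (g \<otimes> k)" using dbl[OF \<open>a \<in> _\<close>] by blast
    have "inv h \<otimes> a = g \<otimes> k" using hk g by (simp add: inv_mult_cancel)
    moreover have "g \<otimes> k \<otimes> inv a = inv h"
      using hk g by (simp add: inv_mult_group m_assoc inv_mult_cancel)
    ultimately show ?thesis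
      using hk by (intro bexI[of _ "inv h"] bexI[of _ k]) (auto simp: l_coset_def)
  qed
  show ?thesis
    unfolding commensuration_data_def
    using \<beta>A by (intro conjI ballI gC finA sub ab last refl funcsetI) auto
qed

end

lemma (in group_hom) image_translate:
  assumes "subgroup Q G" "g \<in> carrier G" "q \<in> Q"
  shows "h ` ((inv q \<otimes> g) <# Q) = (inv\<^bsub>H\<^esub> h q \<otimes>\<^bsub>H\<^esub> h g) <#\<^bsub>H\<^esub> h ` Q"
proof -
  interpret Q: subgroup Q G by fact
  show ?thesis using assms by (simp add: l_coset_def image_UN)
qed

theorem lemma11:
  fixes G1 :: "('a, 'm) monoid_scheme" and G2 :: "('b, 'n) monoid_scheme"
    and f :: "'a \<Rightarrow> 'b" and Q :: "'a set"
  assumes "group G1" and "group G2"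
    and "f \<in> epi G1 G2"
    and "quasi_normal Q G1"
  shows "quasi_normal (f ` Q) G2 \<and>
    (\<exists>(A1 :: 'a \<Rightarrow> 'a set) (\<alpha>1 :: 'a \<Rightarrow> 'a \<Rightarrow> 'a) (\<beta>1 :: 'a \<Rightarrow> 'a \<Rightarrow> 'a)
      (A2 :: 'b \<Rightarrow> 'b set) (\<alpha>2 :: 'b \<Rightarrow> 'b \<Rightarrow> 'b) (\<beta>2 :: 'b \<Rightarrow> 'b \<Rightarrow> 'b).
      (\<forall>g\<in>carrier G1. commensuration_data g Q G1 (A1 g) (\<alpha>1 g) (\<beta>1 g)) \<and>
      (\<forall>g\<^sub>2\<in>carrier G2. commensuration_data g\<^sub>2 (f ` Q) G2 (A2 g\<^sub>2) (\<alpha>2 g\<^sub>2) (\<beta>2 g\<^sub>2)) \<and>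
      (\<forall>g\<in>carrier G1.
         A2 (f g) = f ` A1 g \<and>
         (\<forall>q\<in>Q. \<alpha>2 (f g) (f q) = f (\<alpha>1 g q)) \<and>
         (\<forall>q\<in>Q. \<beta>2 (f g) (f q) = f (\<beta>1 g q))))"
proof -
  interpret group_hom G1 G2 f
    using assms by (auto simp: group_hom_def group_hom_axioms_def epi_def)
  interpret Q: subgroup Q G1 using assms(4) by (simp add: quasi_normal_def)
  have Q: "subgroup Q G1" by unfold_locales
  have P: "subgroup (f ` Q) G2" using Q by (rule subgroup_img_is_subgroup)
  have surj: "f ` carrier G1 = carrier G2" using assms(3) by (simp add: epi_def)
  have comm1: "g \<in> commensurator Q G1" if "g \<in> carrier G1" for g
    using assms(4) that by (simp add: quasi_normal_def)
  have fin: "finite (translates G2 (f ` Q) (f g))" if "g \<in> carrier G1" for g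
  proof -
    have "translates G2 (f ` Q) (f g) = (\<lambda>C. f ` C) ` translates G1 Q g"
      using image_translate[OF Q that] by (simp add: translates_def image_image)
    then show ?thesis using comm1[OF that] G.mem_commensurator_iff[OF Q that] by simp
  qed
  have comm2: "g \<in> commensurator (f ` Q) G2" if g: "g \<in> carrier G2" for g
  proof -
    \<comment> \<open>As \<open>f\<close> sends the inverse of \<open>g1\<close> to the inverse of
      \<open>g\<close>, \<open>fin\<close> covers both sets of translates.\<close>
    obtain g1 where g1: "g1 \<in> carrier G1" "g = f g1" using g surj by blast
    then show ?thesis
      using fin[of g1] fin[of "inv\<^bsub>G1\<^esub> g1"] H.mem_commensurator_iff[OF P g] by simp
  qed
  have qn: "quasi_normal (f ` Q) G2"
    using P comm2 by (auto simp: quasi_normal_def commensurator_def)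
  define r where "r D = (SOME y. y \<in> D)" for D :: "'b set"
  define \<rho> where "\<rho> C = (SOME x. x \<in> C \<and> f x = r (f ` C))" for C
  have r: "r D \<in> D" if "D \<noteq> {}" for D
    unfolding r_def using that by (simp add: some_in_eq)
  \<comment> \<open>The point \<open>r (f\<close> C)\<open>lies in\<close>f \<open>C\<close>, so it
    has a preimage in \<open>C\<close> and the choice defining \<open>\<rho>\<close> can be
    met.\<close>
  have \<rho>: "\<rho> C \<in> C \<and> f (\<rho> C) = r (f ` C)" if "C \<noteq> {}" for C
    unfolding \<rho>_def by (rule someI_ex) (use r[of "f ` C"] that in \<open>auto simp: image_iff\<close>)
  have ne1: "x <#\<^bsub>G1\<^esub> Q \<noteq> {}" for x using Q.one_closed by (force simp: l_coset_def simp del: Q.one_closed)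
  have ne2: "x <#\<^bsub>G2\<^esub> f ` Q \<noteq> {}" for x using Q.one_closed by (force simp: l_coset_def simp del: Q.one_closed)
  define \<alpha>1 where "\<alpha>1 g q = \<rho> ((inv\<^bsub>G1\<^esub> q \<otimes>\<^bsub>G1\<^esub> g) <#\<^bsub>G1\<^esub> Q)" for g q
  define \<beta>1 where "\<beta>1 g q = \<rho> ((inv\<^bsub>G1\<^esub> q \<otimes>\<^bsub>G1\<^esub> inv\<^bsub>G1\<^esub> g) <#\<^bsub>G1\<^esub> Q)" for g q
  define \<alpha>2 where "\<alpha>2 g q = r ((inv\<^bsub>G2\<^esub> q \<otimes>\<^bsub>G2\<^esub> g) <#\<^bsub>G2\<^esub> f ` Q)" for g q
  define \<beta>2 where "\<beta>2 g q = r ((inv\<^bsub>G2\<^esub> q \<otimes>\<^bsub>G2\<^esub> inv\<^bsub>G2\<^esub> g) <#\<^bsub>G2\<^esub> f ` Q)" for g q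
  define A1 where "A1 g = \<alpha>1 g ` Q \<union> set_inv\<^bsub>G1\<^esub> (\<beta>1 g ` Q)" for g
  define A2 where "A2 g = \<alpha>2 g ` f ` Q \<union> set_inv\<^bsub>G2\<^esub> (\<beta>2 g ` f ` Q)" for g
  have data1: "commensuration_data g Q G1 (A1 g) (\<alpha>1 g) (\<beta>1 g)" if "g \<in> carrier G1" for g
    unfolding A1_def \<alpha>1_def[abs_def] \<beta>1_def[abs_def]
    using G.commensuration_data_of_transversal[OF Q comm1[OF that]] \<rho> ne1 by blast
  have data2: "commensuration_data g (f ` Q) G2 (A2 g) (\<alpha>2 g) (\<beta>2 g)" if "g \<in> carrier G2" for g
    unfolding A2_def \<alpha>2_def[abs_def] \<beta>2_def[abs_def]
    using H.commensuration_data_of_transversal[OF P comm2[OF that]] r ne2 by blast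
  \<comment> \<open>Applying \<open>f\<close> to \<open>\<rho>\<close> of a translate gives
    \<open>r\<close> of the image of that translate, which by \<open>image_translate\<close> is the
    coset used by \<open>\<alpha>2\<close>.\<close>
  have \<alpha>: "\<alpha>2 (f g) (f q) = f (\<alpha>1 g q)" if "g \<in> carrier G1" "q \<in> Q" for g q
    using \<rho>[OF ne1] image_translate[OF Q that] by (simp add: \<alpha>1_def \<alpha>2_def)
  have \<beta>: "\<beta>2 (f g) (f q) = f (\<beta>1 g q)" if "g \<in> carrier G1" "q \<in> Q" for g q
    using \<rho>[OF ne1] image_translate[OF Q _ that(2), of "inv\<^bsub>G1\<^esub> g"] that
    by (simp add: \<beta>1_def \<beta>2_def)
  have A: "A2 (f g) = f ` A1 g" if g: "g \<in> carrier G1" for g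
  proof -
    \<comment> \<open>Needed because \<open>f\<close> is known to commute with inversion only on the
      carrier.\<close>
    have "\<beta>1 g q \<in> carrier G1" if "q \<in> Q" for q
    proof -
      have "\<beta>1 g q \<in> (inv\<^bsub>G1\<^esub> q \<otimes>\<^bsub>G1\<^esub> inv\<^bsub>G1\<^esub> g) <#\<^bsub>G1\<^esub> Q"
        using \<rho>[OF ne1] by (simp add: \<beta>1_def)
      then show ?thesis using g that by (auto simp: l_coset_def)
    qed
    then have "f ` (set_inv\<^bsub>G1\<^esub> (\<beta>1 g ` Q)) = set_inv\<^bsub>G2\<^esub> (\<beta>2 (f g) ` f ` Q)"
      using \<beta>[OF g] by (simp add: SET_INV_def image_UN)
    moreover have "f ` \<alpha>1 g ` Q = \<alpha>2 (f g) ` f ` Q"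
      using \<alpha>[OF g] by (simp add: image_image)
    ultimately show ?thesis by (simp add: A1_def A2_def image_Un)
  qed
  show ?thesis
    using qn data1 data2 \<alpha> \<beta> A
    by (intro conjI exI[of _ A1] exI[of _ \<alpha>1] exI[of _ \<beta>1] exI[of _ A2] exI[of _ \<alpha>2] exI[of _ \<beta>2])
      auto
qed

end
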